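(* For every integer $k > 1$, $\mathrm{NTIME}[\log^k n] \subsetneq \mathrm{NTIME}[\log^{k+1} n]$.
   Context: Throughout, $\log n$ denotes $\log_2 n$ and $\log^k n$ denotes $(\log n)^k$. A random-access Turing machine is a multi-tape Turing machine with (1) a read-only random-access input of length $n+1$ whose first $n$ cells contain the input binary string and whose $(n+1)$-st cell contains an endmark $\triangleleft$, (2) a fixed number of read-write working tapes, and (3) a read-write input address-tape of length $\lceil \log n\rceil$ containing bits; at each step the binary number on the address-tape determines the input cell that is read, and if it exceeds $n$ the endmark cell is read. For a function $f$, $\mathrm{NTIME}[f(n)]$ is the class of languages of binary strings accepted by a non-deterministic random-access Turing machine that makes at most $O(f(n))$ steps before accepting an input of length $n$. *)

theory Defs
  imports Complex_Main "HOL-Library.Landau_Symbols"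
begin

text \<open>
  Non-deterministic random-access Turing machines over binary input strings.  States and
  work-tape symbols are natural numbers, drawn from finite sets that belong to the machine, so
  that one can quantify over all machines; the number of work tapes is also part of the machine.
\<close>

datatype dir = Left | Stay | Right

datatype input_symbol = InBit bool | Endmark

text \<open>
  The address tape has a fixed finite length and holds bits only.  The head may step onto the
  two (unwritable) boundary positions next to it, which is how a machine notices the ends.
\<close>

datatype addr_symbol = LeftEnd | AddrBit bool | RightEnd

text \<open>
  A rule pairs (state, scanned input symbol, scanned address-tape symbol, symbols scanned on
  the work tapes) with (new state, (bit written on the address tape, move of its head), and for
  each work tape the symbol written and the move of its head).
\<close>

type_synonym rule =
  "(nat \<times> input_symbol \<times> addr_symbol \<times> nat list) \<times>
   (nat \<times> (bool \<times> dir) \<times> (nat \<times> dir) list)"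

record ratm =
  states :: "nat set"
  alphabet :: "nat set"
  num_tapes :: nat
  start :: nat
  accepting :: "nat set"
  rules :: "rule set"

abbreviation blank :: nat where
  "blank \<equiv> 0"

text \<open>
  The rules form an arbitrary relation: zero, one or several of them may apply to a
  configuration.
\<close>

definition is_ratm :: "ratm \<Rightarrow> bool" where
  "is_ratm M \<longleftrightarrow>
     finite (states M) \<and> finite (alphabet M) \<and> blank \<in> alphabet M \<and>
     start M \<in> states M \<and> accepting M \<subseteq> states M \<and>
     (\<forall>((q, i, a, us), (q', w, acts)) \<in> rules M.
        q \<in> states M \<and> q' \<in> states M \<and>
        length us = num_tapes M \<and> set us \<subseteq> alphabet M \<and>
        length acts = num_tapes M \<and> fst ` set acts \<subseteq> alphabet M)"

text \<open>
  A work tape is infinite in both directions and is given by its contents and head position.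
  Address-tape cells are numbered from \<open>0\<close>; its head position ranges over
  \<open>-1, \<dots>, length (addr c)\<close>, where \<open>-1\<close> and \<open>length (addr c)\<close> are the boundary positions.
\<close>

type_synonym work_tape = "(int \<Rightarrow> nat) \<times> int"

record config =
  state :: nat
  addr :: "bool list"
  addr_head :: int
  work :: "work_tape list"

fun shift :: "dir \<Rightarrow> int \<Rightarrow> int" where
  "shift Left p = p - 1"
| "shift Stay p = p"
| "shift Right p = p + 1"

text \<open>The leftmost cell of the address tape is the most significant bit.\<close>

definition addr_val :: "bool list \<Rightarrow> nat" where
  "addr_val a = horner_sum of_bool 2 (rev a)"

text \<open>
  Input cells are numbered from \<open>0\<close>, so cell \<open>length x\<close> is the one with the endmark; larger
  addresses also read the endmark.
\<close>

definition input_read :: "bool list \<Rightarrow> nat \<Rightarrow> input_symbol" where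
  "input_read x i = (if i < length x then InBit (x ! i) else Endmark)"

definition addr_read :: "bool list \<Rightarrow> int \<Rightarrow> addr_symbol" where
  "addr_read a p =
     (if p < 0 then LeftEnd else if p < int (length a) then AddrBit (a ! nat p) else RightEnd)"

definition addr_write :: "bool list \<Rightarrow> int \<Rightarrow> bool \<Rightarrow> bool list" where
  "addr_write a p b = (if 0 \<le> p \<and> p < int (length a) then a[nat p := b] else a)"

definition addr_shift :: "bool list \<Rightarrow> dir \<Rightarrow> int \<Rightarrow> int" where
  "addr_shift a d p = max (- 1) (min (int (length a)) (shift d p))"

fun tape_read :: "work_tape \<Rightarrow> nat" where
  "tape_read (f, p) = f p"

fun tape_act :: "work_tape \<Rightarrow> nat \<times> dir \<Rightarrow> work_tape" where
  "tape_act (f, p) (s, d) = (f(p := s), shift d p)"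

definition scanned ::
  "bool list \<Rightarrow> config \<Rightarrow> nat \<times> input_symbol \<times> addr_symbol \<times> nat list" where
  "scanned x c =
     (state c, input_read x (addr_val (addr c)), addr_read (addr c) (addr_head c),
      map tape_read (work c))"

definition step :: "ratm \<Rightarrow> bool list \<Rightarrow> config \<Rightarrow> config \<Rightarrow> bool" where
  "step M x c c' \<longleftrightarrow>
     (\<exists>q b d acts. (scanned x c, (q, (b, d), acts)) \<in> rules M \<and>
        c' = \<lparr>state = q,
              addr = addr_write (addr c) (addr_head c) b,
              addr_head = addr_shift (addr c) d (addr_head c),
              work = map2 tape_act (work c) acts\<rparr>)"

text \<open>For inputs of length at most 1 the address tape is empty, as \<open>log 2 0 = 0\<close> here.\<close>

definition init_config :: "ratm \<Rightarrow> bool list \<Rightarrow> config" where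
  "init_config M x =
     \<lparr>state = start M,
      addr = replicate (nat \<lceil>log 2 (real (length x))\<rceil>) False,
      addr_head = 0,
      work = replicate (num_tapes M) (\<lambda>_. blank, 0)\<rparr>"

definition accepts_in :: "ratm \<Rightarrow> bool list \<Rightarrow> nat \<Rightarrow> bool" where
  "accepts_in M x s \<longleftrightarrow>
     (\<exists>c. (step M x ^^ s) (init_config M x) c \<and> state c \<in> accepting M)"

definition language :: "ratm \<Rightarrow> bool list set" where
  "language M = {x. \<exists>s. accepts_in M x s}"

text \<open>
  The usual convention for non-deterministic time: each accepted input has some accepting
  computation within the time bound.
\<close>

definition NTIME :: "(nat \<Rightarrow> real) \<Rightarrow> bool list set set" where
  "NTIME f =
     {L. \<exists>M t. is_ratm M \<and> language M = L \<and> (\<lambda>n. real (t n)) \<in> O(f) \<and>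
           (\<forall>x\<in>L. \<exists>s\<le>t (length x). accepts_in M x s)}"

end

theory Submission
  imports Defs "HOL-Library.Countable"
begin

text \<open>
  No diagonalisation is needed: a computation of \<open>s\<close> steps reads at most \<open>s\<close> input cells, so the
  hierarchy follows from a sensitivity argument.  Let \<open>m\<close> be the length of the address tape and
  consider the addresses with at least one and at most \<open>k + 1\<close> one-bits.  There are about
  \<open>m ^ (k + 1)\<close> of them.  A depth-first search over the positions of the one-bits, carried out on
  the address tape itself, checks in \<open>O(m ^ (k + 1))\<close> steps that all of them hold a 1.  On the
  all-ones input of length \<open>2 ^ m\<close> an accepting computation with \<open>O(m ^ k)\<close> steps misses one of
  these addresses, and therefore also accepts the input in which that bit is flipped.
\<close>

section \<open>Probed addresses\<close>

text \<open>The strings of length \<open>r\<close> with between one and \<open>j\<close> one-bits,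
  generated in the shape of the search tree: place a one-bit and probe that address, search to its
  right with a smaller budget, then put a zero there and search on with the old budget.\<close>

fun probes :: "nat \<Rightarrow> nat \<Rightarrow> bool list set" where
  "probes 0 r = {}"
| "probes (Suc j) 0 = {}"
| "probes (Suc j) (Suc r) =
     insert (True # replicate r False)
       (Cons True ` probes j r \<union> Cons False ` probes (Suc j) r)"

lemma finite_probes: "finite (probes j r)"
  by (induction j r rule: probes.induct) auto

lemma length_probes: "s \<in> probes j r \<Longrightarrow> length s = r"
  by (induction j r arbitrary: s rule: probes.induct) auto

lemma True_in_probes: "s \<in> probes j r \<Longrightarrow> True \<in> set s"
  by (induction j r arbitrary: s rule: probes.induct) auto

text \<open>The extra 1 counts the all-zero string. With it, the recursion of \<open>probes\<close>
  dominates Pascal's rule: the two recursive parts differ in their first bit, and the inserted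
  string is new because every probe contains a one-bit.\<close>

lemma binomial_le_card_probes: "r choose j \<le> card (probes j r) + 1"
proof (induction j r rule: probes.induct)
  case (3 j r)
  have notin: "replicate r False \<notin> probes j r"
    using True_in_probes[of "replicate r False" j r] by auto
  have "card (probes (Suc j) (Suc r)) =
      Suc (card (Cons True ` probes j r \<union> Cons False ` probes (Suc j) r))"
    using notin by (auto simp: finite_probes card_insert_if)
  also have "card (Cons True ` probes j r \<union> Cons False ` probes (Suc j) r) =
      card (probes j r) + card (probes (Suc j) r)"
    by (subst card_Un_disjoint) (auto simp: finite_probes card_image)
  finally show ?case
    using 3 by simp
qed auto

section \<open>Addresses as binary numerals\<close>

lemma addr_val_Cons: "addr_val (b # a) = of_bool b * 2 ^ length a + addr_val a"
  unfolding addr_val_def by (simp add: horner_sum_append)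

lemma addr_val_less: "addr_val a < 2 ^ length a"
proof (induction a)
  case Nil
  then show ?case
    by (simp add: addr_val_def)
qed (auto simp: addr_val_Cons)

lemma addr_val_inject: "length a = length b \<Longrightarrow> addr_val a = addr_val b \<Longrightarrow> a = b"
proof (induction a b rule: list_induct2)
  case (Cons x xs y ys)
  then show ?case
    using addr_val_less[of xs] addr_val_less[of ys]
    by (auto simp: addr_val_Cons of_bool_def split: if_splits)
qed simp

section \<open>The depth-first search machine\<close>

text \<open>The argument of a phase is the number of one-bits that may still be placed.\<close>

datatype phase = Forward nat | Check nat | Backward nat | Accept

instance phase :: countable
  by countable_datatype

text \<open>\<open>Forward\<close> places the next one-bit, \<open>Check\<close> gets stuck unless
  the addressed cell holds a 1, and \<open>Backward\<close> walks left to the last one-bit, erases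
  it and regains its budget. Reaching the left end means that the whole tree has been
  searched.\<close>

fun delta :: "phase \<Rightarrow> input_symbol \<Rightarrow> addr_symbol \<Rightarrow> (phase \<times> bool \<times> dir) option" where
  "delta (Forward 0) i a = Some (Backward 0, False, Left)"
| "delta (Forward (Suc j)) i (AddrBit b) = Some (Check j, True, Stay)"
| "delta (Forward (Suc j)) i RightEnd = Some (Backward (Suc j), False, Left)"
| "delta (Check j) (InBit True) a = Some (Forward j, True, Right)"
| "delta (Backward j) i (AddrBit True) = Some (Forward (Suc j), False, Right)"
| "delta (Backward j) i (AddrBit False) = Some (Backward j, False, Left)"
| "delta (Backward j) i LeftEnd = Some (Accept, False, Stay)"
| "delta _ _ _ = None"

definition phases :: "nat \<Rightarrow> phase set" where
  "phases d = insert Accept (Forward ` {..d} \<union> Check ` {..d} \<union> Backward ` {..d})"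

text \<open>The address tape itself serves as the stack of the search, so no work tape is used.
  Budgets capped at \<open>d\<close> leave finitely many phases, which \<open>to_nat\<close> turns
  into states.\<close>

definition dfs_machine :: "nat \<Rightarrow> ratm" where
  "dfs_machine d =
     \<lparr>states = to_nat ` phases d, alphabet = {blank}, num_tapes = 0,
      start = to_nat (Forward d), accepting = {to_nat Accept},
      rules = {((to_nat q, i, a, []), (to_nat q', (b, e), [])) | q i a q' b e.
                 q \<in> phases d \<and> q' \<in> phases d \<and> delta q i a = Some (q', b, e)}\<rparr>"

definition dfs_config :: "phase \<Rightarrow> bool list \<Rightarrow> int \<Rightarrow> config" where
  "dfs_config q a p = \<lparr>state = to_nat q, addr = a, addr_head = p, work = []\<rparr>"

lemma is_ratm_dfs_machine: "is_ratm (dfs_machine d)"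
  unfolding is_ratm_def dfs_machine_def by (auto simp: phases_def)

lemma state_dfs_config [simp]: "state (dfs_config q a p) = to_nat q"
  by (simp add: dfs_config_def)

lemma step_dfs_config:
  "step (dfs_machine d) x (dfs_config q a p) c \<longleftrightarrow>
     (\<exists>q' b e. q \<in> phases d \<and> q' \<in> phases d \<and>
        delta q (input_read x (addr_val a)) (addr_read a p) = Some (q', b, e) \<and>
        c = dfs_config q' (addr_write a p b) (addr_shift a e p))"
  unfolding step_def dfs_machine_def dfs_config_def scanned_def by auto

lemma right_unique_step: "right_unique (step (dfs_machine d) x)"
  by (rule right_uniqueI) (auto simp: step_def dfs_machine_def)

lemma not_step_accepting:
  assumes "state c \<in> accepting (dfs_machine d)"
  shows "\<not> step (dfs_machine d) x c c'"
  using assms unfolding step_def dfs_machine_def scanned_def by auto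

text \<open>A deterministic run never branches, so a run ending in the terminal \<open>e\<close>
  passes through every point reachable from its start. This removes known initial segments from an
  accepting run.\<close>

lemma right_unique_rtranclp_cancel:
  assumes "right_unique r" "r\<^sup>*\<^sup>* a b" "r\<^sup>*\<^sup>* a e" "\<And>y. \<not> r e y"
  shows "r\<^sup>*\<^sup>* b e"
  using assms(2,3)
proof (induction rule: converse_rtranclp_induct)
  case (step a a')
  have "a \<noteq> e"
    using step.hyps(1) assms(4) by auto
  then obtain a'' where "r a a''" "r\<^sup>*\<^sup>* a'' e"
    using step.prems by (metis converse_rtranclpE)
  then show ?case
    using step assms(1) by (metis right_uniqueD)
qed

text \<open>The summands list, in order, the steps for marking, checking, the left subtree,
  unmarking, the right subtree and moving back. They are kept apart so that a run can be composed
  summand by summand.\<close>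

fun dfs_time :: "nat \<Rightarrow> nat \<Rightarrow> nat" where
  "dfs_time 0 r = 1"
| "dfs_time (Suc j) 0 = 1"
| "dfs_time (Suc j) (Suc r) = 1 + 1 + dfs_time j r + 1 + dfs_time (Suc j) r + 1"

text \<open>Adding 4 absorbs the four single steps per node: the shifted quantity is exactly the sum
  of its two predecessors, with value 5 at the leaves.\<close>

lemma dfs_time_le: "dfs_time j r + 4 \<le> 5 * (r + 1) ^ j"
proof (induction j r rule: dfs_time.induct)
  case (3 j r)
  have "dfs_time (Suc j) (Suc r) + 4 \<le> 5 * (r + 1) ^ j + 5 * (r + 1) ^ Suc j"
    using 3 by simp
  also have "\<dots> = 5 * ((r + 1) ^ j * (r + 2))"
    by (simp add: algebra_simps)
  also have "\<dots> \<le> 5 * ((r + 2) ^ j * (r + 2))"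
    by (intro mult_mono power_mono) auto
  finally show ?case
    by (simp add: mult.commute)
qed auto

section \<open>Correctness of the depth-first search\<close>

abbreviation holds_one :: "bool list \<Rightarrow> bool list \<Rightarrow> bool" where
  "holds_one x a \<equiv> input_read x (addr_val a) = InBit True"

lemma step_mark:
  assumes "Suc j \<le> d"
  shows "step (dfs_machine d) x
    (dfs_config (Forward (Suc j)) (a @ replicate (Suc r) False) (int (length a)))
    (dfs_config (Check j) (a @ True # replicate r False) (int (length a)))"
  using assms
  by (simp add: step_dfs_config phases_def addr_read_def addr_write_def addr_shift_def
      nth_append list_update_append ex_bool_eq add.commute)

lemma step_check:
  assumes "j \<le> d" "holds_one x (a @ True # replicate r False)"
  shows "step (dfs_machine d) x
    (dfs_config (Check j) (a @ True # replicate r False) (int (length a)))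
    (dfs_config (Forward j) ((a @ [True]) @ replicate r False) (int (length (a @ [True]))))"
  using assms
  by (simp add: step_dfs_config phases_def addr_read_def addr_write_def addr_shift_def
      nth_append list_update_append ex_bool_eq add.commute)

lemma step_unmark:
  assumes "Suc j \<le> d"
  shows "step (dfs_machine d) x
    (dfs_config (Backward j) ((a @ [True]) @ replicate r False) (int (length (a @ [True])) - 1))
    (dfs_config (Forward (Suc j)) ((a @ [False]) @ replicate r False) (int (length (a @ [False]))))"
  using assms
  by (simp add: step_dfs_config phases_def addr_read_def addr_write_def addr_shift_def
      nth_append list_update_append ex_bool_eq add.commute)

lemma step_back:
  assumes "j \<le> d"
  shows "step (dfs_machine d) x
    (dfs_config (Backward j) ((a @ [False]) @ replicate r False) (int (length (a @ [False])) - 1))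
    (dfs_config (Backward j) (a @ replicate (Suc r) False) (int (length a) - 1))"
  using assms
  by (simp add: step_dfs_config phases_def addr_read_def addr_write_def addr_shift_def
      nth_append list_update_append ex_bool_eq add.commute)

text \<open>The leaves of the search: either the budget or the tape is exhausted. The
  \<open>False\<close> written here falls on a zero cell or on the unwritable boundary, so the tape
  is unchanged.\<close>

lemma step_turn:
  assumes "j \<le> d" "j = 0 \<or> r = 0"
  shows "step (dfs_machine d) x
    (dfs_config (Forward j) (a @ replicate r False) (int (length a)))
    (dfs_config (Backward j) (a @ replicate r False) (int (length a) - 1))"
proof -
  have "addr_write (a @ replicate r False) (int (length a)) False = a @ replicate r False"
    by (cases r) (auto simp: addr_write_def list_update_append)
  moreover have "delta (Forward j) i (addr_read (a @ replicate r False) (int (length a))) =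
      Some (Backward j, False, Left)" for i
    using assms(2) by (cases j) (auto simp: addr_read_def)
  ultimately show ?thesis
    using assms(1) by (simp add: step_dfs_config phases_def addr_shift_def ex_bool_eq)
qed

lemma relpowp_trans: "(R ^^ m) a b \<Longrightarrow> (R ^^ n) b c \<Longrightarrow> (R ^^ (m + n)) a c"
  by (auto simp: relpowp_add)

text \<open>The invariant is that a successful search of a subtree restores its zeros and leaves the
  head just left of it with the original budget. The prefix \<open>a\<close> varies because each
  recursive search fixes one more bit.\<close>

lemma dfs_complete:
  assumes "j \<le> d" "\<forall>s\<in>probes j r. holds_one x (a @ s)"
  shows "(step (dfs_machine d) x ^^ dfs_time j r)
    (dfs_config (Forward j) (a @ replicate r False) (int (length a)))
    (dfs_config (Backward j) (a @ replicate r False) (int (length a) - 1))"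
  using assms
proof (induction j r arbitrary: a rule: probes.induct)
  case (1 r)
  then show ?case
    using step_turn[of 0 d r x a] by (simp add: eq_OO)
next
  case (2 j)
  then show ?case
    using step_turn[of "Suc j" d 0 x a] by (simp add: eq_OO)
next
  case (3 j r)
  let ?S = "step (dfs_machine d) x"
  have check: "holds_one x (a @ True # replicate r False)"
    using "3.prems" by simp
  have left: "(?S ^^ dfs_time j r)
      (dfs_config (Forward j) ((a @ [True]) @ replicate r False) (int (length (a @ [True]))))
      (dfs_config (Backward j) ((a @ [True]) @ replicate r False) (int (length (a @ [True])) - 1))"
    using "3.prems" by (intro "3.IH"(1)) auto
  have right: "(?S ^^ dfs_time (Suc j) r)
      (dfs_config (Forward (Suc j)) ((a @ [False]) @ replicate r False) (int (length (a @ [False]))))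
      (dfs_config (Backward (Suc j)) ((a @ [False]) @ replicate r False)
        (int (length (a @ [False])) - 1))"
    using "3.prems" by (intro "3.IH"(2)) auto
  have mark: "(?S ^^ 1)
      (dfs_config (Forward (Suc j)) (a @ replicate (Suc r) False) (int (length a)))
      (dfs_config (Check j) (a @ True # replicate r False) (int (length a)))"
    unfolding relpowp_1 by (rule step_mark[OF "3.prems"(1)])
  have descend: "(?S ^^ 1)
      (dfs_config (Check j) (a @ True # replicate r False) (int (length a)))
      (dfs_config (Forward j) ((a @ [True]) @ replicate r False) (int (length (a @ [True]))))"
    unfolding relpowp_1 by (rule step_check[OF Suc_leD[OF "3.prems"(1)] check])
  have turn: "(?S ^^ 1)
      (dfs_config (Backward j) ((a @ [True]) @ replicate r False) (int (length (a @ [True])) - 1))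
      (dfs_config (Forward (Suc j)) ((a @ [False]) @ replicate r False) (int (length (a @ [False]))))"
    unfolding relpowp_1 by (rule step_unmark[OF "3.prems"(1)])
  have up: "(?S ^^ 1)
      (dfs_config (Backward (Suc j)) ((a @ [False]) @ replicate r False)
        (int (length (a @ [False])) - 1))
      (dfs_config (Backward (Suc j)) (a @ replicate (Suc r) False) (int (length a) - 1))"
    unfolding relpowp_1 by (rule step_back[OF "3.prems"(1)])
  show ?case
    unfolding dfs_time.simps
    by (intro relpowp_trans[OF _ up] relpowp_trans[OF _ right] relpowp_trans[OF _ turn]
      relpowp_trans[OF _ left] relpowp_trans[OF mark] descend)
qed

text \<open>By determinism the accepting run must follow the path of the search, so each
  \<open>Check\<close> on the way has succeeded.\<close>

lemma dfs_sound:
  assumes "(step (dfs_machine d) x)\<^sup>*\<^sup>*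
      (dfs_config (Forward j) (a @ replicate r False) (int (length a))) e"
    and "state e = to_nat Accept" "j \<le> d"
  shows "\<forall>s\<in>probes j r. holds_one x (a @ s)"
  using assms(1,3)
proof (induction j r arbitrary: a rule: probes.induct)
  case (3 j r)
  let ?S = "step (dfs_machine d) x"
  have final: "\<not> ?S e c" for c
    using not_step_accepting[of e d x c] assms(2) by (simp add: dfs_machine_def)
  note cancel = right_unique_rtranclp_cancel[OF right_unique_step _ _ final]
  let ?c = "dfs_config (Check j) (a @ True # replicate r False) (int (length a))"
  have c: "?S\<^sup>*\<^sup>* ?c e"
    using cancel[OF r_into_rtranclp[of ?S] "3.prems"(1)] step_mark[OF "3.prems"(2)] by blast
  have "?c \<noteq> e"
    using assms(2) by auto
  then obtain c' where "?S ?c c'"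
    using c by (metis converse_rtranclpE)
  \<comment> \<open>The only rule that leaves \<open>Check\<close> reads a 1.\<close>
  then have check: "holds_one x (a @ True # replicate r False)"
    unfolding step_dfs_config by (auto elim!: delta.elims)
  have left: "?S\<^sup>*\<^sup>*
      (dfs_config (Forward j) ((a @ [True]) @ replicate r False) (int (length (a @ [True])))) e"
    using cancel[OF r_into_rtranclp[of ?S] c] step_check[OF _ check, of j d] "3.prems"(2)
    by fastforce
  then have probes_left: "\<forall>s\<in>probes j r. holds_one x ((a @ [True]) @ s)"
    using "3.prems"(2) by (intro "3.IH"(1)) auto
  \<comment> \<open>Once the left probes are known to hold 1, completeness carries the run through
    the left subtree to the point of backtracking.\<close>
  have "?S\<^sup>*\<^sup>*
      (dfs_config (Backward j) ((a @ [True]) @ replicate r False) (int (length (a @ [True])) - 1)) e"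
    using cancel[OF relpowp_imp_rtranclp left] dfs_complete[OF _ probes_left, of d] "3.prems"(2)
    by (meson Suc_leD)
  then have "?S\<^sup>*\<^sup>*
      (dfs_config (Forward (Suc j)) ((a @ [False]) @ replicate r False) (int (length (a @ [False])))) e"
    using cancel[OF r_into_rtranclp[of ?S]] step_unmark[OF "3.prems"(2)] by blast
  then have "\<forall>s\<in>probes (Suc j) r. holds_one x ((a @ [False]) @ s)"
    using "3.prems"(2) by (intro "3.IH"(2)) auto
  then show ?case
    using check probes_left by auto
qed auto

section \<open>Language and running time of the machine\<close>

abbreviation addr_length :: "bool list \<Rightarrow> nat" where
  "addr_length x \<equiv> nat \<lceil>log 2 (real (length x))\<rceil>"

lemma init_config_dfs_machine:
  "init_config (dfs_machine d) x =
     dfs_config (Forward d) (replicate (addr_length x) False) 0"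
  by (simp add: init_config_def dfs_machine_def dfs_config_def)

lemma dfs_machine_accepts:
  assumes "\<forall>a\<in>probes d (addr_length x). holds_one x a"
  shows "accepts_in (dfs_machine d) x (dfs_time d (addr_length x) + 1)"
proof -
  let ?a = "replicate (addr_length x) False"
  have "(step (dfs_machine d) x ^^ dfs_time d (addr_length x))
      (init_config (dfs_machine d) x) (dfs_config (Backward d) ?a (-1))"
    using dfs_complete[of d d "addr_length x" x "[]"] assms
    by (simp add: init_config_dfs_machine)
  \<comment> \<open>With the empty prefix the search ends on the left boundary position -1, where
    one further step accepts.\<close>
  moreover have "step (dfs_machine d) x (dfs_config (Backward d) ?a (-1))
      (dfs_config Accept ?a (-1))"
    by (auto simp: step_dfs_config phases_def addr_read_def addr_write_def addr_shift_def)
  moreover have "state (dfs_config Accept ?a (-1)) \<in> accepting (dfs_machine d)"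
    by (simp add: dfs_machine_def)
  ultimately show ?thesis
    unfolding accepts_in_def Suc_eq_plus1[symmetric] by (blast intro: relpowp_Suc_I)
qed

lemma language_dfs_machine:
  "language (dfs_machine d) = {x. \<forall>a\<in>probes d (addr_length x). holds_one x a}"
proof (intro equalityI subsetI)
  fix x assume "x \<in> language (dfs_machine d)"
  then obtain e where "(step (dfs_machine d) x)\<^sup>*\<^sup>* (init_config (dfs_machine d) x) e"
    and "state e = to_nat Accept"
    unfolding language_def accepts_in_def
    by (auto dest: relpowp_imp_rtranclp simp: dfs_machine_def)
  then show "x \<in> {x. \<forall>a\<in>probes d (addr_length x). holds_one x a}"
    using dfs_sound[of d x d "[]" "addr_length x" e]
    by (simp add: init_config_dfs_machine)
next
  fix x assume "x \<in> {x. \<forall>a\<in>probes d (addr_length x). holds_one x a}"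
  then show "x \<in> language (dfs_machine d)"
    unfolding language_def using dfs_machine_accepts by blast
qed

lemma language_dfs_machine_in_NTIME:
  "language (dfs_machine d) \<in> NTIME (\<lambda>n. log 2 (real n) ^ d)"
proof -
  define t where "t n = dfs_time d (nat \<lceil>log 2 (real n)\<rceil>) + 1" for n
  have "(\<lambda>n. real (t n)) \<in> O(\<lambda>n. log 2 (real n) ^ d)"
  proof (rule bigoI, rule eventually_at_top_linorderI)
    fix n :: nat assume "n \<ge> 2"
    define m where "m = nat \<lceil>log 2 (real n)\<rceil>"
    have log: "log 2 (real n) \<ge> 1"
      using \<open>n \<ge> 2\<close> by simp
    have "real (t n) \<le> real (5 * (m + 1) ^ d)"
      unfolding t_def m_def[symmetric] using dfs_time_le[of d m] by (intro of_nat_mono) simp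
    also have "\<dots> = 5 * (real m + 1) ^ d"
      by (simp add: add.commute)
    \<comment> \<open>The ceiling adds less than 1, so the left side is below
      \<open>log 2 (real n) + 2\<close>; the logarithm is at least 1.\<close>
    also have "real m + 1 \<le> 3 * log 2 (real n)"
      using log unfolding m_def by linarith
    then have "5 * (real m + 1) ^ d \<le> 5 * (3 * log 2 (real n)) ^ d"
      by (intro mult_left_mono power_mono) auto
    finally show "norm (real (t n)) \<le> (5 * 3 ^ d) * norm (log 2 (real n) ^ d)"
      using log by (simp add: power_mult_distrib)
  qed
  moreover have "\<forall>x\<in>language (dfs_machine d).
      \<exists>s\<le>t (length x). accepts_in (dfs_machine d) x s"
    unfolding language_dfs_machine t_def using dfs_machine_accepts by auto
  ultimately show ?thesis
    unfolding NTIME_def using is_ratm_dfs_machine by blast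
qed

section \<open>Few steps read few cells\<close>

text \<open>A step depends on the input only through the one addressed cell. Collecting these
  addresses along a fixed run gives \<open>I\<close>, and the same run can be replayed on any input
  agreeing there.\<close>

lemma relpowp_step_reads:
  assumes "(step M x ^^ s) c c'"
  shows "\<exists>I. finite I \<and> card I \<le> s \<and>
    (\<forall>y. length y = length x \<and> (\<forall>i\<in>I. input_read y i = input_read x i) \<longrightarrow>
       (step M y ^^ s) c c')"
  using assms
proof (induction s arbitrary: c')
  case 0
  then show ?case
    by (intro exI[of _ "{}"]) auto
next
  case (Suc s)
  obtain c1 where "(step M x ^^ s) c c1" and last: "step M x c1 c'"
    using Suc.prems by (rule relpowp_Suc_E)
  from Suc.IH[OF this(1)] obtain I where I: "finite I" "card I \<le> s"
    "\<forall>y. length y = length x \<and> (\<forall>i\<in>I. input_read y i = input_read x i) \<longrightarrow>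
       (step M y ^^ s) c c1"
    by blast
  let ?I = "insert (addr_val (addr c1)) I"
  have "(step M y ^^ Suc s) c c'"
    if "length y = length x" "\<forall>i\<in>?I. input_read y i = input_read x i" for y
  proof (rule relpowp_Suc_I)
    show "(step M y ^^ s) c c1"
      using I(3) that by auto
    show "step M y c1 c'"
      using last that unfolding step_def scanned_def by simp
  qed
  moreover have "card ?I \<le> Suc s"
    using I(1,2) card_insert_le_m1[of "Suc s" I "addr_val (addr c1)"] by simp
  ultimately show ?case
    using I(1) by (intro exI[of _ ?I]) auto
qed

lemma accepts_in_reads:
  assumes "accepts_in M x s"
  obtains I where "finite I" "card I \<le> s"
    "\<And>y. length y = length x \<Longrightarrow> (\<And>i. i \<in> I \<Longrightarrow> input_read y i = input_read x i) \<Longrightarrow>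
       accepts_in M y s"
proof -
  obtain c where "(step M x ^^ s) (init_config M x) c" "state c \<in> accepting M"
    using assms unfolding accepts_in_def by blast
  moreover have "init_config M y = init_config M x" if "length y = length x" for y
    using that by (simp add: init_config_def)
  ultimately show thesis
    using relpowp_step_reads[of s M x "init_config M x" c] that
    unfolding accepts_in_def by metis
qed

lemma card_probes_le_accepting_time:
  assumes "language M = language (dfs_machine d)"
    and "accepts_in M (replicate (2 ^ m) True) s"
  shows "card (probes d m) \<le> s"
proof (rule ccontr)
  assume "\<not> card (probes d m) \<le> s"
  let ?x = "replicate (2 ^ m) True"
  obtain I where I: "finite I" "card I \<le> s"
    "\<And>y. length y = length ?x \<Longrightarrow> (\<And>i. i \<in> I \<Longrightarrow> input_read y i = input_read ?x i) \<Longrightarrow>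
       accepts_in M y s"
    using accepts_in_reads[OF assms(2)] by metis
  \<comment> \<open>All probes have length \<open>m\<close>, so distinct ones address distinct cells
    and cannot all be covered by the smaller set \<open>I\<close>.\<close>
  have "inj_on addr_val (probes d m)"
    by (rule inj_onI) (metis addr_val_inject length_probes)
  then have "card I < card (addr_val ` probes d m)"
    using I(2) \<open>\<not> _\<close> by (simp add: card_image)
  then have "\<not> addr_val ` probes d m \<subseteq> I"
    using card_mono[OF I(1)] by (meson leD)
  then obtain a where a: "a \<in> probes d m" "addr_val a \<notin> I"
    by blast
  let ?y = "?x[addr_val a := False]"
  have "accepts_in M ?y s"
  proof (rule I(3))
    fix i assume "i \<in> I"
    then have "i \<noteq> addr_val a"
      using a(2) by auto
    then show "input_read ?y i = input_read ?x i"
      by (simp add: input_read_def)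
  qed simp
  then have "?y \<in> language (dfs_machine d)"
    using assms(1) unfolding language_def by auto
  \<comment> \<open>Flipping a bit keeps the length, so the same probes are required of
    \<open>?y\<close>; since \<open>addr_val a < 2 ^ m\<close>, the flip hits a genuine input cell
    and falsifies one of them.\<close>
  moreover have "addr_length ?y = m"
    by (simp add: log_nat_power)
  ultimately have "holds_one ?y a"
    using a(1) unfolding language_dfs_machine by simp
  then show False
    using addr_val_less[of a] length_probes[OF a(1)] by (simp add: input_read_def)
qed

section \<open>Growth of binomial coefficients and the separation\<close>

lemma binomial_Suc_exceeds_power:
  fixes C :: real
  obtains m where "m \<ge> M" "C * real m ^ k + 1 < real (m choose Suc k)"
proof -
  \<comment> \<open>The bound \<open>(m / Suc k) ^ Suc k\<close> on the binomial coefficient equals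
    \<open>m ^ Suc k / D\<close>, so it suffices that \<open>m / D\<close> is at least
    \<open>\<bar>C\<bar> + 2\<close>. Of the 2, one unit absorbs the added 1 and the other gives
    strictness.\<close>
  define D where "D = real (Suc k) ^ Suc k"
  obtain m where m: "real m \<ge> max (max (real M) (real (Suc k))) (D * (\<bar>C\<bar> + 2))"
    using real_arch_simple by blast
  have "D > 0"
    by (simp add: D_def del: of_nat_Suc)
  have "m \<ge> Suc k"
    using m by linarith
  then have pow: "real m ^ k \<ge> 1"
    by (intro one_le_power) linarith
  have "C * real m ^ k + 1 < (\<bar>C\<bar> + 2) * real m ^ k"
    using pow mult_right_mono[of C "\<bar>C\<bar>" "real m ^ k"]
    unfolding distrib_right by linarith
  also have "\<dots> \<le> (real m / D) * real m ^ k"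
    using m \<open>D > 0\<close> by (intro mult_right_mono) (auto simp: field_simps)
  also have "\<dots> = (real m / real (Suc k)) ^ Suc k"
    unfolding D_def by (simp add: power_divide)
  also have "\<dots> \<le> real (m choose Suc k)"
    using binomial_ge_n_over_k_pow_k[OF \<open>m \<ge> Suc k\<close>, where 'a = real] by simp
  finally show thesis
    using that m by auto
qed

lemma language_dfs_machine_notin_NTIME:
  "language (dfs_machine (Suc k)) \<notin> NTIME (\<lambda>n. log 2 (real n) ^ k)"
proof
  assume "language (dfs_machine (Suc k)) \<in> NTIME (\<lambda>n. log 2 (real n) ^ k)"
  then obtain M t where M: "language M = language (dfs_machine (Suc k))"
    and t: "(\<lambda>n. real (t n)) \<in> O(\<lambda>n. log 2 (real n) ^ k)"
    and accepts: "\<forall>x\<in>language (dfs_machine (Suc k)). \<exists>s\<le>t (length x). accepts_in M x s"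
    unfolding NTIME_def by auto
  obtain C where "\<forall>\<^sub>F n in at_top. norm (real (t n)) \<le> C * norm (log 2 (real n) ^ k)"
    using landau_o.bigE[OF t] by blast
  then obtain N where N: "\<And>n. n \<ge> N \<Longrightarrow> real (t n) \<le> C * norm (log 2 (real n) ^ k)"
    unfolding eventually_at_top_linorder by auto
  obtain m where m: "m \<ge> N" "C * real m ^ k + 1 < real (m choose Suc k)"
    using binomial_Suc_exceeds_power by blast
  \<comment> \<open>Length \<open>2 ^ m\<close> makes the logarithm exactly \<open>m\<close> and
    puts every \<open>m\<close>-bit address before the endmark.\<close>
  let ?x = "replicate (2 ^ m) True"
  have "addr_length ?x = m"
    by (simp add: log_nat_power)
  then have "?x \<in> language (dfs_machine (Suc k))"
    unfolding language_dfs_machine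
    using addr_val_less length_probes by (fastforce simp: input_read_def)
  then obtain s where "s \<le> t (2 ^ m)" "accepts_in M ?x s"
    using accepts by fastforce
  then have "real (card (probes (Suc k) m)) \<le> real (t (2 ^ m))"
    using card_probes_le_accepting_time[OF M] by fastforce
  also have "N \<le> 2 ^ m"
    using m(1) less_exp[of m] by linarith
  then have "real (t (2 ^ m)) \<le> C * real m ^ k"
    using N[of "2 ^ m"] by (simp add: log_nat_power)
  finally show False
    using m(2) binomial_le_card_probes[of m "Suc k"] by linarith
qed

lemma NTIME_mono:
  assumes "f \<in> O(g)"
  shows "NTIME f \<subseteq> NTIME g"
  unfolding NTIME_def using landau_o.big_trans[OF _ assms] by blast

theorem theorem2:
  fixes k :: nat
  assumes "k > 1"
  shows "NTIME (\<lambda>n. (log 2 (real n)) ^ k) \<subset> NTIME (\<lambda>n. (log 2 (real n)) ^ (k + 1))"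
proof -
  have "(\<lambda>n. log 2 (real n) ^ k) \<in> O(\<lambda>n. log 2 (real n) ^ (k + 1))"
  proof (rule bigoI[where c = 1], rule eventually_at_top_linorderI)
    fix n :: nat assume "n \<ge> 2"
    then have "log 2 (real n) \<ge> 1"
      by simp
    then show "norm (log 2 (real n) ^ k) \<le> 1 * norm (log 2 (real n) ^ (k + 1))"
      using power_increasing[of k "k + 1" "log 2 (real n)"] by simp
  qed
  \<comment> \<open>The search with up to \<open>k + 1\<close> one-bits witnesses
    strictness.\<close>
  then show ?thesis
    using NTIME_mono language_dfs_machine_in_NTIME[of "Suc k"] language_dfs_machine_notin_NTIME[of k]
    by (metis Suc_eq_plus1 psubsetI)
qed

end
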